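(* Let $\mu$ be a probability measure on $\mathbb{R}^d$ with density $V^{-d}$, where $V$ is a positive function satisfying, for a constant $A$, $$|\nabla \log V(x)|\le A(1+|x|)^{-1}\qquad \text{for all } x\in\mathbb{R}^d.$$ Let $\nu$ be a probability measure on $\mathbb{R}^d$ which satisfies an exponential concentration inequality with parameters $(c,\sigma)$. Then the Brenier map $T$ from $\mu$ onto $\nu$ satisfies $$|T(x)|\le 2\sqrt{cd}\,\sigma+3\sigma d\left(d^{-1}\log c+\log V(0)+2A\log 2+3A+2-d^{-1}\log\omega_d+2A\log(1+|x|)\right),$$ where $\omega_d$ is the volume of the unit ball in dimension $d$.
   Context: $|\cdot|$ is the Euclidean norm. A probability measure $\nu$ on $\mathbb{R}^d$ satisfies an exponential concentration inequality with parameters $(c,\sigma)$ if for every $1$-Lipschitz function $f$ and every $r\ge 0$ one has $$\nu\left(\left\{f\ge \int f\,d\nu+r\right\}\right)\le c\exp(-r/\sigma).$$ Brenier map: for $\mu$ absolutely continuous with respect to Lebesgue measure and $\nu$ any probability measure on $\mathbb{R}^d$, there is a convex function $\phi$ such that $T=\nabla\phi$ pushes $\mu$ forward to $\nu$, and $T$ is the unique transport map of this form up to null sets (Brenier–McCann theorem). This $T$ is the Brenier map.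
   Formalization: The measure ν is additionally assumed to have barycenter 0; without this the claim is false (ν a Dirac mass at a far-away point y gives T = y, while the bound does not depend on y). *)

theory Defs
  imports "HOL-Probability.Probability"
begin

(* The integrability clause makes the Bochner integral of f meaningful; without it the integral
   of a non-integrable f would silently be 0. *)
definition exp_concentration :: "'a::euclidean_space measure \<Rightarrow> real \<Rightarrow> real \<Rightarrow> bool" where
  "exp_concentration \<nu> c \<sigma> \<longleftrightarrow>
     (\<forall>f :: 'a \<Rightarrow> real. 1-lipschitz_on UNIV f \<longrightarrow>
        integrable \<nu> f \<and>
        (\<forall>r\<ge>0. measure \<nu> {x \<in> space \<nu>. f x \<ge> (\<integral>y. f y \<partial>\<nu>) + r} \<le> c * exp (- r / \<sigma>)))"

(* T is a Brenier map from \<mu> onto \<nu> with convex potential \<phi>.  A convex function has a gradient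
   only almost everywhere, so T is the gradient of \<phi> off a \<mu>-null set, and arbitrary there.
   The potential is taken finite on the whole space.  This loses nothing when \<mu> has an
   everywhere positive density: a convex set of full measure is then the whole space. *)
definition brenier_map ::
    "'a::euclidean_space measure \<Rightarrow> 'a measure \<Rightarrow> ('a \<Rightarrow> real) \<Rightarrow> ('a \<Rightarrow> 'a) \<Rightarrow> bool" where
  "brenier_map \<mu> \<nu> \<phi> T \<longleftrightarrow>
     convex_on UNIV \<phi> \<and>
     T \<in> borel_measurable \<mu> \<and>
     (AE x in \<mu>. GDERIV \<phi> x :> T x) \<and>
     distr \<mu> borel T = \<nu>"

end

theory Submission
  imports Defs "HOL-Real_Asymp.Real_Asymp"
begin

text \<open>
  Let \<open>e\<close> be the unit direction of \<open>T x\<close> and \<open>B\<close> the unit ball centred at \<open>x + 3 e\<close>. Monotonicity of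
  the gradient gives \<open>\<bar>T y\<bar> \<ge> \<bar>T x\<bar> / 2\<close> for almost all \<open>y \<in> B\<close>, so \<open>\<mu> B \<le> \<nu> {\<bar>z\<bar> \<ge> \<bar>T x\<bar> / 2}\<close>, and
  concentration of \<open>z \<mapsto> \<bar>z\<bar>\<close> yields \<open>\<bar>T x\<bar> / 2 \<le> \<integral> \<bar>z\<bar> d\<nu> + \<sigma> ln (c / \<mu> B)\<close>. The logarithmic
  gradient bound gives \<open>V y \<le> V 0 (1 + \<bar>y\<bar>)\<^sup>A\<close>, hence a lower bound on \<open>\<mu> B\<close>. The first
  moment is controlled by the variances of the coordinates: the tail \<open>min 1 (2 c exp (- t))\<close> is at
  most \<open>sqrt (2 c) exp (- t / 2)\<close>, so they grow only like \<open>sqrt c\<close>, which absorbs the factor 2.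
\<close>

section \<open>Gradients of convex functions\<close>

lemma convex_on_above_gradient:
  fixes \<phi> :: "'a::real_inner \<Rightarrow> real"
  assumes "convex_on UNIV \<phi>" and "GDERIV \<phi> x :> D"
  shows "\<phi> y \<ge> \<phi> x + D \<bullet> (y - x)"
proof -
  \<comment> \<open>Restriction to the line through \<open>x\<close> and \<open>y\<close> reduces
    the claim to the tangent inequality for a convex function of one real variable.\<close>
  define g where "g t = \<phi> (x + t *\<^sub>R (y - x))" for t :: real
  have "convex_on UNIV g"
  proof (rule convex_onI)
    fix t u v :: real assume t: "0 < t" "t < 1"
    have eq: "x + ((1 - t) *\<^sub>R u + t *\<^sub>R v) *\<^sub>R (y - x)
        = (1 - t) *\<^sub>R (x + u *\<^sub>R (y - x)) + t *\<^sub>R (x + v *\<^sub>R (y - x))"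
      by (simp add: algebra_simps)
    show "g ((1 - t) *\<^sub>R u + t *\<^sub>R v) \<le> (1 - t) * g u + t * g v"
      unfolding g_def eq using t by (intro convex_onD[OF assms(1)]) auto
  qed simp
  moreover have "(g has_real_derivative D \<bullet> (y - x)) (at 0)"
  proof -
    have "(\<phi> has_derivative (\<lambda>h. h \<bullet> D)) (at (x + 0 *\<^sub>R (y - x)))"
      using assms(2) by (simp add: gderiv_def)
    moreover have "((\<lambda>t::real. x + t *\<^sub>R (y - x)) has_derivative (\<lambda>t. t *\<^sub>R (y - x))) (at 0)"
      by (auto intro!: derivative_eq_intros)
    ultimately have "(g has_derivative (\<lambda>t. (t *\<^sub>R (y - x)) \<bullet> D)) (at 0)"
      unfolding g_def by (rule has_derivative_compose[rotated])
    then show ?thesis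
      by (simp add: has_field_derivative_def inner_commute mult_commute_abs)
  qed
  ultimately have "g 1 - g 0 \<ge> (D \<bullet> (y - x)) * (1 - 0)"
    using convex_on_imp_above_tangent[of UNIV g 0 1 "D \<bullet> (y - x)"]
    by simp
  then show ?thesis by (simp add: g_def)
qed

text \<open>Adding the tangent inequalities at \<open>x\<close> and at \<open>y\<close> cancels the
  values of the function.\<close>

lemma convex_on_gradient_monotone:
  fixes \<phi> :: "'a::real_inner \<Rightarrow> real"
  assumes "convex_on UNIV \<phi>" and "GDERIV \<phi> x :> D" and "GDERIV \<phi> y :> E"
  shows "D \<bullet> (y - x) \<le> E \<bullet> (y - x)"
  using convex_on_above_gradient[OF assms(1,2), of y] convex_on_above_gradient[OF assms(1,3), of x]
  by (simp add: inner_diff_right)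

text \<open>For \<open>y\<close> in the ball, \<open>y - x\<close> has component at least 2 along
  \<open>e\<close> and length at most 4. Monotonicity and Cauchy-Schwarz then give
  \<open>2 * norm D \<le> 4 * norm E\<close>. A centre at distance \<open>s\<close> would give the
  ratio \<open>(s - 1) / (s + 1)\<close>, and \<open>s = 3\<close> makes it one half.\<close>

lemma norm_gradient_ball_le:
  fixes \<phi> :: "'a::real_inner \<Rightarrow> real"
  assumes "convex_on UNIV \<phi>" and "GDERIV \<phi> x :> D" and "GDERIV \<phi> y :> E"
    and D: "D = norm D *\<^sub>R e" and e: "norm e = 1" and y: "y \<in> ball (x + 3 *\<^sub>R e) 1"
  shows "norm D / 2 \<le> norm E"
proof -
  define w where "w = y - (x + 3 *\<^sub>R e)"
  have w: "norm w < 1"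
    using y by (simp add: w_def dist_norm norm_minus_commute)
  have yx: "y - x = 3 *\<^sub>R e + w" by (simp add: w_def)
  have "\<bar>e \<bullet> w\<bar> \<le> norm e * norm w" by (rule Cauchy_Schwarz_ineq2)
  then have "2 \<le> e \<bullet> (y - x)"
    using w e by (simp add: yx inner_add_right dot_square_norm)
  then have "norm D * 2 \<le> norm D * (e \<bullet> (y - x))"
    by (intro mult_left_mono) auto
  also have "\<dots> = D \<bullet> (y - x)"
    by (subst (2) D) simp
  also have "\<dots> \<le> E \<bullet> (y - x)"
    by (rule convex_on_gradient_monotone[OF assms(1-3)])
  also have "\<dots> \<le> norm E * norm (y - x)" by (rule norm_cauchy_schwarz)
  also have "\<dots> \<le> norm E * 4"
    using norm_triangle_ineq[of "3 *\<^sub>R e" w] w e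
    by (intro mult_left_mono) (auto simp: yx)
  finally show ?thesis by simp
qed

section \<open>Logarithmic growth from gradient decay\<close>

lemma log_gradient_growth:
  fixes F :: "'a::real_inner \<Rightarrow> real"
  assumes F: "\<And>y. GDERIV F y :> G y"
    and G: "\<And>y. norm (G y) \<le> A * inverse (1 + norm y)"
  shows "F y \<le> F 0 + A * ln (1 + norm y)"
proof -
  \<comment> \<open>The subtracted term has derivative \<open>A * norm y / (1 + t * norm y)\<close>,
    exactly the bound that the hypothesis on \<open>G\<close> gives along the segment from 0 to
    \<open>y\<close>, so \<open>h\<close> is nonincreasing.\<close>
  define h where "h t = F (t *\<^sub>R y) - A * ln (1 + t * norm y)" for t :: real
  have "h 1 \<le> h 0"
  proof (rule DERIV_nonpos_imp_nonincreasing[of 0 1 h])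
    fix t :: real assume t: "0 \<le> t" "t \<le> 1"
    then have pos: "0 < 1 + t * norm y" by (simp add: add_pos_nonneg)
    have "((\<lambda>t. F (t *\<^sub>R y)) has_derivative (\<lambda>s. (s *\<^sub>R y) \<bullet> G (t *\<^sub>R y))) (at t)"
      by (rule has_derivative_compose[where g = F])
        (auto intro!: derivative_eq_intros F[unfolded gderiv_def])
    then have "((\<lambda>t. F (t *\<^sub>R y)) has_real_derivative G (t *\<^sub>R y) \<bullet> y) (at t)"
      by (simp add: has_field_derivative_def inner_commute mult_commute_abs)
    then have "(h has_real_derivative G (t *\<^sub>R y) \<bullet> y - A * (norm y / (1 + t * norm y))) (at t)"
      unfolding h_def using pos by (auto intro!: derivative_eq_intros)
    moreover have "G (t *\<^sub>R y) \<bullet> y \<le> A * (norm y / (1 + t * norm y))"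
    proof -
      have "G (t *\<^sub>R y) \<bullet> y \<le> norm (G (t *\<^sub>R y)) * norm y" by (rule norm_cauchy_schwarz)
      also have "\<dots> \<le> (A * inverse (1 + norm (t *\<^sub>R y))) * norm y"
        by (intro mult_right_mono G) simp
      finally show ?thesis using t by (simp add: divide_inverse mult_ac)
    qed
    ultimately show "\<exists>D. (h has_real_derivative D) (at t) \<and> D \<le> 0" by force
  qed simp
  then show ?thesis by (simp add: h_def)
qed

section \<open>Second moments from exponential tails\<close>

lemma nn_integral_id_exp_half:
  "(\<integral>\<^sup>+t. ennreal (t * exp (- t / 2)) * indicator {0..} t \<partial>lborel) = ennreal 4"
proof -
  \<comment> \<open>The antiderivative \<open>- (2 * t + 4) * exp (- t / 2)\<close> vanishes at
    infinity and is -4 at 0.\<close>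
  have "((\<lambda>t::real. - (2 * t + 4) * exp (- t / 2)) \<longlongrightarrow> 0) at_top" by real_asymp
  then have "(\<integral>\<^sup>+t. ennreal (t * exp (- t / 2)) * indicator {0..} t \<partial>lborel)
      = ennreal (0 - (- (2 * 0 + 4) * exp (- 0 / 2)))"
    by (intro nn_integral_FTC_atLeast) (auto intro!: derivative_eq_intros simp: algebra_simps)
  then show ?thesis by simp
qed

text \<open>Layer-cake formula: the second moment is the integral of \<open>2 * t\<close> times the
  tail at \<open>t\<close>. Replacing the tail bound by its square root halves the decay rate, but
  leaves only \<open>sqrt K\<close> in front.\<close>

lemma nn_integral_square_of_exp_tail:
  fixes h :: "'a \<Rightarrow> real"
  assumes prob: "prob_space M" and [measurable]: "h \<in> borel_measurable M"
    and nonneg: "\<And>z. h z \<ge> 0" and K: "K \<ge> 0"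
    and tail: "\<And>t. t \<ge> 0 \<Longrightarrow> measure M {z \<in> space M. h z \<ge> t} \<le> K * exp (- t)"
  shows "(\<integral>\<^sup>+z. ennreal ((h z)\<^sup>2) \<partial>M) \<le> ennreal (8 * sqrt K)"
proof -
  interpret prob_space M by fact
  interpret pair_sigma_finite M lborel ..
  have sq: "ennreal ((h z)\<^sup>2) = (\<integral>\<^sup>+t. ennreal (2 * t) * indicator {0..h z} t \<partial>lborel)" for z
  proof -
    have "(\<integral>\<^sup>+t. ennreal (2 * t) * indicator {0..h z} t \<partial>lborel) = ennreal ((h z)\<^sup>2 - 0\<^sup>2)"
      using nonneg[of z] by (intro nn_integral_FTC_Icc) (auto intro!: derivative_eq_intros)
    then show ?thesis by simp
  qed
  have "(\<integral>\<^sup>+z. ennreal ((h z)\<^sup>2) \<partial>M)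
      = (\<integral>\<^sup>+z. \<integral>\<^sup>+t. ennreal (2 * t) * indicator {0..h z} t \<partial>lborel \<partial>M)"
    by (simp add: sq)
  also have "\<dots> = (\<integral>\<^sup>+t. \<integral>\<^sup>+z. ennreal (2 * t) * indicator {0..h z} t \<partial>M \<partial>lborel)"
    \<comment> \<open>Written as a condition on the pair of \<open>z\<close> and \<open>t\<close>,
      the integrand is visibly jointly measurable.\<close>
    unfolding indicator_def atLeastAtMost_iff by (rule Fubini'[symmetric]) measurable
  also have "\<dots> \<le> (\<integral>\<^sup>+t. ennreal (2 * sqrt K) * (ennreal (t * exp (- t / 2)) * indicator {0..} t) \<partial>lborel)"
  proof (rule nn_integral_mono)
    fix t :: real
    show "(\<integral>\<^sup>+z. ennreal (2 * t) * indicator {0..h z} t \<partial>M)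
        \<le> ennreal (2 * sqrt K) * (ennreal (t * exp (- t / 2)) * indicator {0..} t)"
    proof (cases "t \<ge> 0")
      case True
      define p where "p = prob {z \<in> space M. h z \<ge> t}"
      \<comment> \<open>Since \<open>p\<close> is at most 1, its square obeys the same tail bound,
        and the root can be taken.\<close>
      have "p * p \<le> 1 * p"
        unfolding p_def by (intro mult_right_mono) auto
      also have "\<dots> \<le> K * exp (- t)" using tail[OF True] by (simp add: p_def)
      finally have "p \<le> sqrt (K * exp (- t))"
        by (intro real_le_rsqrt) (simp add: power2_eq_square)
      also have "sqrt (exp (- t)) = exp (- t / 2)"
        by (rule real_sqrt_unique) (auto simp: power2_eq_square simp flip: exp_add)
      then have "sqrt (K * exp (- t)) = sqrt K * exp (- t / 2)" by (simp add: real_sqrt_mult)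
      finally have p: "p \<le> sqrt K * exp (- t / 2)" .
      have "(\<integral>\<^sup>+z. ennreal (2 * t) * indicator {0..h z} t \<partial>M)
          = (\<integral>\<^sup>+z. ennreal (2 * t) * indicator {z \<in> space M. h z \<ge> t} z \<partial>M)"
        using True by (intro nn_integral_cong) (auto simp: indicator_def)
      also have "\<dots> = ennreal (2 * t) * emeasure M {z \<in> space M. h z \<ge> t}"
        by (rule nn_integral_cmult_indicator) measurable
      also have "\<dots> = ennreal (2 * t * p)"
        using True by (simp add: emeasure_eq_measure p_def ennreal_mult)
      also have "\<dots> \<le> ennreal (2 * t * (sqrt K * exp (- t / 2)))"
        using True p by (intro ennreal_leI mult_left_mono) auto
      also have "\<dots> = ennreal (2 * sqrt K) * (ennreal (t * exp (- t / 2)) * indicator {0..} t)"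
        using True K by (simp add: mult_ac flip: ennreal_mult)
      finally show ?thesis .
    qed (auto simp: indicator_def)
  qed
  also have "\<dots> = ennreal (2 * sqrt K) * ennreal 4"
    by (subst nn_integral_cmult) (simp_all only: nn_integral_id_exp_half, measurable)
  also have "\<dots> = ennreal (8 * sqrt K)"
    using K by (simp flip: ennreal_mult del: ennreal_numeral)
  finally show ?thesis .
qed

section \<open>First moment of a centred measure with exponential concentration\<close>

text \<open>For the constant function 0 and \<open>r = 0\<close> the event is the whole space, of
  mass 1. This keeps \<open>ln c\<close> nonnegative later.\<close>

lemma exp_concentration_const_ge_1:
  assumes "exp_concentration \<nu> c \<sigma>" and "prob_space \<nu>"
  shows "c \<ge> 1"
proof -
  interpret prob_space \<nu> by fact
  have "1-lipschitz_on UNIV (\<lambda>x::'a. 0::real)" by (auto intro!: lipschitz_onI)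
  with assms(1) have "prob {x \<in> space \<nu>. (0::real) \<ge> (\<integral>y. 0 \<partial>\<nu>) + 0} \<le> c * exp (- 0 / \<sigma>)"
    unfolding exp_concentration_def by blast
  then show ?thesis by (simp add: prob_space)
qed

text \<open>Concentration is one-sided, so it is applied to the linear functionals of
  \<open>b\<close> and of \<open>- b\<close>, both of mean 0. The union bound gives the tail
  constant \<open>2 * c\<close>. The result is stated as a square in preparation for taking a
  root.\<close>

lemma exp_concentration_coordinate:
  fixes \<nu> :: "'a::euclidean_space measure"
  assumes conc: "exp_concentration \<nu> c \<sigma>" and prob: "prob_space \<nu>"
    and sets[measurable_cong]: "sets \<nu> = sets borel"
    and centered: "(\<integral>y. y \<partial>\<nu>) = 0" and sigma: "\<sigma> > 0" and b: "b \<in> Basis"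
  shows "(\<integral>\<^sup>+z. ennreal ((z \<bullet> b)\<^sup>2) \<partial>\<nu>) \<le> ennreal (\<sigma>\<^sup>2 * (sqrt c + 3)\<^sup>2)"
proof -
  interpret prob_space \<nu> by fact
  have c: "c \<ge> 1" by (rule exp_concentration_const_ge_1[OF conc prob])
  have lip: "1-lipschitz_on UNIV (\<lambda>z::'a. z \<bullet> u)" if "norm u = 1" for u
  proof (rule lipschitz_onI)
    fix y z :: 'a
    show "dist (y \<bullet> u) (z \<bullet> u) \<le> 1 * dist y z"
      using Cauchy_Schwarz_ineq2[of "y - z" u] that by (simp add: dist_norm inner_diff_left)
  qed simp
  \<comment> \<open>The integrability clause of \<open>exp_concentration\<close>, applied to the
    norm, makes the identity integrable, so inner products commute with the mean.\<close>
  have "1-lipschitz_on UNIV (norm :: 'a \<Rightarrow> real)"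
    by (intro lipschitz_onI) (auto simp: dist_norm norm_triangle_ineq3)
  then have "integrable \<nu> (norm :: 'a \<Rightarrow> real)"
    using conc by (auto simp: exp_concentration_def)
  then have int: "integrable \<nu> (\<lambda>z::'a. z)"
    by (rule integrable_norm_cancel) measurable
  have one_sided: "prob {z \<in> space \<nu>. z \<bullet> u \<ge> r} \<le> c * exp (- r / \<sigma>)"
    if "norm u = 1" "r \<ge> 0" for u r
  proof -
    have "(\<integral>z. z \<bullet> u \<partial>\<nu>) = 0"
      using int centered by simp
    moreover have "prob {z \<in> space \<nu>. z \<bullet> u \<ge> (\<integral>z. z \<bullet> u \<partial>\<nu>) + r} \<le> c * exp (- r / \<sigma>)"
      using conc lip[OF that(1)] that(2) unfolding exp_concentration_def by blast
    ultimately show ?thesis by simp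
  qed
  have "prob {z \<in> space \<nu>. \<bar>z \<bullet> b\<bar> / \<sigma> \<ge> t} \<le> (2 * c) * exp (- t)" if t: "t \<ge> 0" for t
  proof -
    have "{z \<in> space \<nu>. \<bar>z \<bullet> b\<bar> / \<sigma> \<ge> t}
        = {z \<in> space \<nu>. z \<bullet> b \<ge> t * \<sigma>} \<union> {z \<in> space \<nu>. z \<bullet> (- b) \<ge> t * \<sigma>}"
      using sigma by (auto simp: pos_le_divide_eq)
    also have "prob \<dots> \<le> prob {z \<in> space \<nu>. z \<bullet> b \<ge> t * \<sigma>} + prob {z \<in> space \<nu>. z \<bullet> (- b) \<ge> t * \<sigma>}"
      by (rule measure_Un_le) measurable
    also have "\<dots> \<le> c * exp (- (t * \<sigma>) / \<sigma>) + c * exp (- (t * \<sigma>) / \<sigma>)"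
      using b t sigma by (intro add_mono one_sided) auto
    finally show ?thesis using sigma by simp
  qed
  then have "(\<integral>\<^sup>+z. ennreal ((\<bar>z \<bullet> b\<bar> / \<sigma>)\<^sup>2) \<partial>\<nu>) \<le> ennreal (8 * sqrt (2 * c))"
    using c sigma by (intro nn_integral_square_of_exp_tail prob) auto
  \<comment> \<open>With \<open>s = sqrt c\<close> and \<open>sqrt 2 \<le> 3 / 2\<close> the left
    side is at most \<open>12 * s\<close>, and \<open>12 * s \<le> (s + 3)\<^sup>2\<close> amounts
    to \<open>(s - 3)\<^sup>2 \<ge> 0\<close>; hence the constant 3.\<close>
  also have "8 * sqrt (2 * c) \<le> (sqrt c + 3)\<^sup>2"
  proof -
    have "sqrt 2 \<le> 3 / 2" by (rule real_le_lsqrt) (auto simp: power2_eq_square)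
    then have "8 * (sqrt 2 * sqrt c) \<le> 8 * (3 / 2 * sqrt c)"
      using c by (intro mult_left_mono mult_right_mono) auto
    also have "\<dots> \<le> (sqrt c + 3)\<^sup>2"
      using zero_le_power2[of "sqrt c - 3"] by (simp add: power2_eq_square algebra_simps)
    finally show ?thesis by (simp add: real_sqrt_mult)
  qed
  finally have bound: "(\<integral>\<^sup>+z. ennreal ((\<bar>z \<bullet> b\<bar> / \<sigma>)\<^sup>2) \<partial>\<nu>) \<le> ennreal ((sqrt c + 3)\<^sup>2)"
    by (simp add: ennreal_leI)
  have "(\<integral>\<^sup>+z. ennreal ((z \<bullet> b)\<^sup>2) \<partial>\<nu>)
      = (\<integral>\<^sup>+z. ennreal (\<sigma>\<^sup>2) * ennreal ((\<bar>z \<bullet> b\<bar> / \<sigma>)\<^sup>2) \<partial>\<nu>)"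
    using sigma by (intro nn_integral_cong) (simp add: power_divide flip: ennreal_mult)
  also have "\<dots> = ennreal (\<sigma>\<^sup>2) * (\<integral>\<^sup>+z. ennreal ((\<bar>z \<bullet> b\<bar> / \<sigma>)\<^sup>2) \<partial>\<nu>)"
    by (rule nn_integral_cmult) measurable
  also have "\<dots> \<le> ennreal (\<sigma>\<^sup>2) * ennreal ((sqrt c + 3)\<^sup>2)"
    by (intro mult_left_mono bound) simp
  finally show ?thesis by (simp add: ennreal_mult)
qed

text \<open>The coordinates are summed at the level of second moments, so the dimension enters only
  through its square root.\<close>

lemma exp_concentration_first_moment:
  fixes \<nu> :: "'a::euclidean_space measure"
  assumes conc: "exp_concentration \<nu> c \<sigma>" and prob: "prob_space \<nu>"
    and sets[measurable_cong]: "sets \<nu> = sets borel"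
    and centered: "(\<integral>y. y \<partial>\<nu>) = 0" and sigma: "\<sigma> > 0"
  shows "(\<integral>z. norm z \<partial>\<nu>) \<le> \<sigma> * (sqrt DIM('a) * (sqrt c + 3))"
proof -
  interpret prob_space \<nu> by fact
  define a where "a = \<sigma> * (sqrt DIM('a) * (sqrt c + 3))"
  have "c \<ge> 1" by (rule exp_concentration_const_ge_1[OF conc prob])
  then have a: "a > 0" unfolding a_def using sigma by (intro mult_pos_pos add_nonneg_pos) auto
  have "(norm z)\<^sup>2 = (\<Sum>b\<in>Basis. (z \<bullet> b)\<^sup>2)" for z :: 'a
    unfolding power2_norm_eq_inner by (subst euclidean_inner) (simp add: power2_eq_square)
  then have "(\<integral>\<^sup>+z. ennreal ((norm z)\<^sup>2) \<partial>\<nu>) = (\<integral>\<^sup>+z. (\<Sum>b\<in>Basis. ennreal ((z \<bullet> b)\<^sup>2)) \<partial>\<nu>)"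
    by simp
  also have "\<dots> = (\<Sum>b\<in>Basis. \<integral>\<^sup>+z. ennreal ((z \<bullet> b)\<^sup>2) \<partial>\<nu>)"
    by (rule nn_integral_sum) measurable
  also have "\<dots> \<le> (\<Sum>b\<in>(Basis::'a set). ennreal (\<sigma>\<^sup>2 * (sqrt c + 3)\<^sup>2))"
    by (intro sum_mono exp_concentration_coordinate[OF assms])
  also have "\<dots> = ennreal (a\<^sup>2)"
    by (subst sum_ennreal) (auto simp: a_def power_mult_distrib mult_ac)
  finally have nn: "(\<integral>\<^sup>+z. ennreal ((norm z)\<^sup>2) \<partial>\<nu>) \<le> ennreal (a\<^sup>2)" .
  have int2: "integrable \<nu> (\<lambda>z. (norm z)\<^sup>2)"
    using nn by (intro integrableI_nonneg) (auto simp: order.strict_trans1)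
  have "ennreal (\<integral>z. (norm z)\<^sup>2 \<partial>\<nu>) \<le> ennreal (a\<^sup>2)"
    using nn by (subst nn_integral_eq_integral[OF int2, symmetric]) auto
  then have sq: "(\<integral>z. (norm z)\<^sup>2 \<partial>\<nu>) \<le> a\<^sup>2" by simp
  \<comment> \<open>In place of Jensen's inequality: the pointwise arithmetic-geometric mean
    inequality, whose right side integrates to at most \<open>a\<close> because the second moment is
    at most \<open>a\<^sup>2\<close>.\<close>
  have "(\<integral>z. norm z \<partial>\<nu>) \<le> (\<integral>z. ((norm z)\<^sup>2 / a + a) / 2 \<partial>\<nu>)"
  proof (rule integral_mono')
    show "integrable \<nu> (\<lambda>z. ((norm z)\<^sup>2 / a + a) / 2)" using int2 by simp
    fix z :: 'a
    have "2 * a * norm z \<le> (norm z)\<^sup>2 + a\<^sup>2"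
      using sum_squares_bound[of a "norm z"] by (simp add: power2_eq_square)
    then show "norm z \<le> ((norm z)\<^sup>2 / a + a) / 2"
      using a by (simp add: field_simps power2_eq_square)
  qed (use a in simp)
  also have "\<dots> = ((\<integral>z. (norm z)\<^sup>2 \<partial>\<nu>) / a + a) / 2"
    using int2 by (simp add: prob_space)
  also have "\<dots> \<le> (a\<^sup>2 / a + a) / 2"
    using sq a by (simp add: divide_right_mono)
  also have "\<dots> = a" using a by (simp add: power2_eq_square)
  finally show ?thesis by (simp add: a_def)
qed

section \<open>Mass of unit balls and its transport\<close>

lemma density_powr_ball_lower:
  fixes V :: "'a::euclidean_space \<Rightarrow> real"
  assumes V_pos: "\<And>y. V y > 0" and V_cont: "continuous_on UNIV V"
    and prob: "prob_space (density lborel (\<lambda>y. ennreal (V y powr - d)))" and d: "d \<ge> 0"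
    and L: "\<And>y. y \<in> ball a 1 \<Longrightarrow> ln (V y) \<le> L"
  shows "measure (density lborel (\<lambda>y. ennreal (V y powr - d))) (ball a 1)
           \<ge> exp (- d * L) * measure lborel (ball (0::'a) 1)"
proof -
  let ?\<mu> = "density lborel (\<lambda>y. ennreal (V y powr - d))"
  interpret prob_space ?\<mu> by fact
  have [measurable]: "V \<in> borel_measurable borel"
    using V_cont by (rule borel_measurable_continuous_onI)
  have vol: "measure lborel (ball a 1) = measure lborel (ball (0::'a) 1)"
    by (simp add: content_ball)
  have "ennreal (exp (- d * L) * measure lborel (ball a 1))
      = ennreal (exp (- d * L)) * emeasure lborel (ball a 1)"
  proof -
    have "emeasure lborel (ball a 1) = ennreal (measure lborel (ball a 1))"
      using emeasure_lborel_ball_finite[of a 1] by (intro emeasure_eq_ennreal_measure) auto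
    then show ?thesis by (simp only: ennreal_mult[OF exp_ge_zero measure_nonneg])
  qed
  also have "\<dots> = (\<integral>\<^sup>+y. ennreal (exp (- d * L)) * indicator (ball a 1) y \<partial>lborel)"
    by (simp add: nn_integral_cmult_indicator)
  also have "\<dots> \<le> (\<integral>\<^sup>+y. ennreal (V y powr - d) * indicator (ball a 1) y \<partial>lborel)"
  proof (rule nn_integral_mono)
    fix y
    show "ennreal (exp (- d * L)) * indicator (ball a 1) y
        \<le> ennreal (V y powr - d) * indicator (ball a 1) y"
    proof (cases "y \<in> ball a 1")
      case True
      have "d * ln (V y) \<le> d * L" using L[OF True] d by (rule mult_left_mono)
      then show ?thesis
        using True V_pos[of y] by (simp add: powr_def ennreal_leI)
    qed simp
  qed
  also have "\<dots> = emeasure ?\<mu> (ball a 1)"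
    by (rule emeasure_density[symmetric]) measurable
  finally show ?thesis by (simp add: vol emeasure_eq_measure)
qed

lemma brenier_map_norm_bound:
  fixes \<mu> \<nu> :: "'a::euclidean_space measure"
  assumes brenier: "brenier_map \<mu> \<nu> \<phi> T" and T_grad: "GDERIV \<phi> x :> T x"
    and mu_prob: "prob_space \<mu>" and mu_sets: "sets \<mu> = sets borel"
    and nu_prob: "prob_space \<nu>" and sigma: "\<sigma> > 0" and conc: "exp_concentration \<nu> c \<sigma>"
    and e: "T x = norm (T x) *\<^sub>R e" "norm e = 1"
    and pos: "0 < q" "q \<le> measure \<mu> (ball (x + 3 *\<^sub>R e) 1)"
  shows "norm (T x) / 2 \<le> (\<integral>z. norm z \<partial>\<nu>) + \<sigma> * (ln c - ln q)"
proof -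
  interpret \<mu>: prob_space \<mu> by fact
  let ?B = "ball (x + 3 *\<^sub>R e) 1" and ?m = "\<integral>z. norm z \<partial>\<nu>"
  have c: "c \<ge> 1" by (rule exp_concentration_const_ge_1[OF conc nu_prob])
  have convex: "convex_on UNIV \<phi>" and [measurable]: "T \<in> borel_measurable \<mu>"
    and ae: "AE y in \<mu>. GDERIV \<phi> y :> T y" and distr: "distr \<mu> borel T = \<nu>"
    using brenier by (auto simp: brenier_map_def)
  have "q \<le> 1" using pos(2) \<mu>.prob_le_1 by (rule order.trans)
  \<comment> \<open>Concentration needs a nonnegative deviation \<open>norm (T x) / 2 - ?m\<close>.
    When it is negative, \<open>q \<le> 1 \<le> c\<close> makes the logarithmic term nonnegative and
    the bound is immediate.\<close>
  show ?thesis
  proof (cases "norm (T x) / 2 \<ge> ?m")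
    case True
    have "q \<le> \<mu>.prob {y \<in> space \<mu>. norm (T y) \<ge> norm (T x) / 2}"
    proof (rule order.trans[OF pos(2)], rule \<mu>.finite_measure_mono_AE)
      \<comment> \<open>The gradient must exist at the fixed point \<open>x\<close>, but only at
        almost every \<open>y\<close> of the ball.\<close>
      show "AE y in \<mu>. y \<in> ?B \<longrightarrow> y \<in> {y \<in> space \<mu>. norm (T y) \<ge> norm (T x) / 2}"
        using ae AE_space
        by eventually_elim (use norm_gradient_ball_le[OF convex T_grad _ e] in blast)
    qed measurable
    also have "\<dots> = measure \<nu> {z \<in> space \<nu>. norm z \<ge> norm (T x) / 2}"
      by (subst (1 2) distr[symmetric], subst measure_distr)
        (auto intro!: arg_cong[where f = \<mu>.prob])
    also have "\<dots> = measure \<nu> {z \<in> space \<nu>. norm z \<ge> ?m + (norm (T x) / 2 - ?m)}" by simp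
    also have "\<dots> \<le> c * exp (- (norm (T x) / 2 - ?m) / \<sigma>)"
    proof -
      have "1-lipschitz_on UNIV (norm :: 'a \<Rightarrow> real)"
        by (intro lipschitz_onI) (auto simp: dist_norm norm_triangle_ineq3)
      moreover have "norm (T x) / 2 - ?m \<ge> 0" using True by simp
      ultimately show ?thesis using conc unfolding exp_concentration_def by blast
    qed
    finally have "ln q \<le> ln (c * exp (- (norm (T x) / 2 - ?m) / \<sigma>))"
      using pos(1) by (intro ln_mono) auto
    also have "\<dots> = ln c - (norm (T x) / 2 - ?m) / \<sigma>"
      using c by (simp add: ln_mult diff_divide_distrib)
    finally have "(norm (T x) / 2 - ?m) / \<sigma> \<le> ln c - ln q" by simp
    then show ?thesis using sigma by (simp add: pos_divide_le_eq mult.commute)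
  next
    case False
    have "0 \<le> \<sigma> * (ln c - ln q)" using c sigma pos \<open>q \<le> 1\<close> by simp
    then show ?thesis using False by simp
  qed
qed

text \<open>Translating \<nu> translates \<open>T\<close> and preserves concentration, while the
  right side stays the same; fixing the mean at 0 removes this freedom. The bound is asserted
  wherever \<phi> has gradient \<open>T x\<close>, hence at \<mu>-almost every
  \<open>x\<close>.\<close>

theorem theorem4p2:
  fixes V :: "'a::euclidean_space \<Rightarrow> real"
    and G :: "'a \<Rightarrow> 'a"
    and \<mu> \<nu> :: "'a measure"
    and \<phi> :: "'a \<Rightarrow> real"
    and T :: "'a \<Rightarrow> 'a"
    and x :: "'a"
    and A c \<sigma> d \<omega> :: real
  defines "d \<equiv> real DIM('a)"
    and "\<omega> \<equiv> measure lborel (ball (0::'a) 1)"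
  assumes V_pos: "\<And>y. V y > 0"
    and V_grad: "\<And>y. GDERIV (\<lambda>z. ln (V z)) y :> G y"
    and V_bound: "\<And>y. norm (G y) \<le> A * inverse (1 + norm y)"
    and mu: "\<mu> = density lborel (\<lambda>y. ennreal (V y powr (- d)))"
    and mu_prob: "prob_space \<mu>"
    and nu_sets: "sets \<nu> = sets borel"
    and nu_prob: "prob_space \<nu>"
    and nu_centered: "(\<integral>y. y \<partial>\<nu>) = 0"
    and sigma_pos: "\<sigma> > 0"
    and nu_conc: "exp_concentration \<nu> c \<sigma>"
    and brenier: "brenier_map \<mu> \<nu> \<phi> T"
    and T_grad: "GDERIV \<phi> x :> T x"
  shows "norm (T x) \<le> 2 * sqrt (c * d) * \<sigma> + 3 * \<sigma> * d *
           (ln c / d + ln (V 0) + 2 * A * ln 2 + 3 * A + 2 - ln \<omega> / d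
            + 2 * A * ln (1 + norm x))"
proof -
  interpret \<mu>: prob_space \<mu> by fact
  have d: "d \<ge> 1" by (simp add: d_def DIM_positive Suc_leI)
  have c: "c \<ge> 1" by (rule exp_concentration_const_ge_1[OF nu_conc nu_prob])
  have \<omega>: "\<omega> > 0" by (simp add: \<omega>_def content_ball_pos)
  have A: "A \<ge> 0" using order.trans[OF norm_ge_zero V_bound[of 0]] by simp
  \<comment> \<open>If \<open>T x = 0\<close>, any unit vector serves as direction.\<close>
  obtain e :: 'a where e: "T x = norm (T x) *\<^sub>R e" "norm e = 1"
  proof (cases "T x = 0")
    case True
    obtain b :: 'a where "b \<in> Basis" using nonempty_Basis by blast
    with True show ?thesis by (intro that[of b]) auto
  next
    case False
    then show ?thesis by (intro that[of "T x /\<^sub>R norm (T x)"]) auto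
  qed
  \<comment> \<open>Differentiability is given for \<open>ln V\<close>; exponentiating passes
    continuity on to \<open>V\<close>, which makes the density measurable.\<close>
  have V_cont: "continuous_on UNIV V"
  proof -
    have "continuous_on UNIV (\<lambda>y. ln (V y))"
      using V_grad unfolding gderiv_def
      by (intro continuous_at_imp_continuous_on ballI has_derivative_continuous) blast
    then have "continuous_on UNIV (\<lambda>y. exp (ln (V y)))" by (rule continuous_on_exp)
    then show ?thesis using V_pos by simp
  qed
  \<comment> \<open>The 5 arises from \<open>norm y \<le> norm x + 4\<close> on the ball, so that
    \<open>1 + norm y \<le> 5 * (1 + norm x)\<close>.\<close>
  define L where "L = ln (V 0) + A * (ln 5 + ln (1 + norm x))"
  have L: "ln (V y) \<le> L" if y: "y \<in> ball (x + 3 *\<^sub>R e) 1" for y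
  proof -
    have "norm y \<le> norm (y - (x + 3 *\<^sub>R e)) + norm (x + 3 *\<^sub>R e)"
      using norm_triangle_sub[of y "x + 3 *\<^sub>R e"] by simp
    also have "\<dots> \<le> 1 + (norm x + 3)"
      using y norm_triangle_ineq[of x "3 *\<^sub>R e"] e(2)
      by (intro add_mono) (auto simp: dist_norm norm_minus_commute)
    finally have "1 + norm y \<le> 5 * (1 + norm x)"
      using norm_ge_zero[of x] unfolding distrib_left by linarith
    then have "ln (1 + norm y) \<le> ln (5 * (1 + norm x))"
      by (intro ln_mono) (auto intro: add_pos_nonneg)
    also have "\<dots> = ln 5 + ln (1 + norm x)"
      by (rule ln_mult_pos) (auto intro: add_pos_nonneg)
    finally have "A * ln (1 + norm y) \<le> A * (ln 5 + ln (1 + norm x))"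
      using A by (rule mult_left_mono)
    then show ?thesis
      using log_gradient_growth[OF V_grad V_bound, of y] by (simp add: L_def)
  qed
  define q where "q = exp (- d * L) * \<omega>"
  have q: "0 < q" "q \<le> \<mu>.prob (ball (x + 3 *\<^sub>R e) 1)"
    using \<omega> density_powr_ball_lower[OF V_pos V_cont mu_prob[unfolded mu] _ L] d
    by (auto simp: q_def \<omega>_def mu)
  define S where "S = ln c - ln q"
  have "q \<le> 1" using q(2) \<mu>.prob_le_1 by (rule order.trans)
  then have S: "S \<ge> 0" using c q(1) by (simp add: S_def)
  have "norm (T x) / 2 \<le> (\<integral>z. norm z \<partial>\<nu>) + \<sigma> * S"
    unfolding S_def
    by (rule brenier_map_norm_bound[OF brenier T_grad mu_prob _ nu_prob sigma_pos nu_conc e q])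
      (simp add: mu)
  also have "(\<integral>z. norm z \<partial>\<nu>) \<le> \<sigma> * (sqrt d * (sqrt c + 3))"
    unfolding d_def
    by (rule exp_concentration_first_moment[OF nu_conc nu_prob nu_sets nu_centered sigma_pos])
  \<comment> \<open>As \<open>d \<ge> 1\<close>, the summand \<open>3 * sqrt d\<close> may be raised
    to \<open>3 * d\<close>, to join the terms linear in \<open>d\<close>.\<close>
  also have "\<dots> \<le> \<sigma> * (sqrt (c * d) + 3 * d)"
  proof -
    have "sqrt d \<le> d" using d by (intro real_le_lsqrt) (auto simp: power2_eq_square)
    then show ?thesis
      using sigma_pos by (intro mult_left_mono) (auto simp: real_sqrt_mult algebra_simps)
  qed
  finally have "norm (T x) \<le> 2 * sqrt (c * d) * \<sigma> + \<sigma> * (6 * d + 2 * S)"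
    by (simp add: algebra_simps)
  \<comment> \<open>Here \<open>6 * d = 3 * (d * 2)\<close> becomes the summand 2 of the claimed
    bracket, and \<open>S \<ge> 0\<close> lets \<open>2 * S\<close> be raised to the common factor
    3.\<close>
  also have "6 * d + 2 * S \<le> 3 * (S + d * 2)" using S by simp
  also have "S + d * 2 \<le> d * (ln c / d + ln (V 0) + 2 * A * ln 2 + 3 * A + 2 - ln \<omega> / d
            + 2 * A * ln (1 + norm x))"
  proof -
    \<comment> \<open>The claimed constants leave slack: \<open>ln 5\<close> is replaced by
      \<open>2 * ln 2 + 3\<close>, and the coefficient of the nonnegative
      \<open>ln (1 + norm x)\<close> is doubled.\<close>
    have "ln (5::real) \<le> 4" using ln_le_minus_one[of "5::real"] by simp
    also have "(4::real) \<le> 2 * ln 2 + 3" using ln2_ge_two_thirds by simp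
    finally have "A * (ln 5 + ln (1 + norm x)) \<le> A * (2 * ln 2 + 3 + 2 * ln (1 + norm x))"
      using A by (intro mult_left_mono add_mono) auto
    then have "L \<le> ln (V 0) + 2 * A * ln 2 + 3 * A + 2 * A * ln (1 + norm x)"
      by (simp add: L_def algebra_simps)
    then have "d * L \<le> d * (ln (V 0) + 2 * A * ln 2 + 3 * A + 2 * A * ln (1 + norm x))"
      using d by (intro mult_left_mono) auto
    moreover have "S = ln c + d * L - ln \<omega>"
      using \<omega> by (simp add: S_def q_def ln_mult)
    ultimately show ?thesis using d by (simp add: algebra_simps)
  qed
  finally show ?thesis
    using sigma_pos by (simp add: mult_ac mult_left_mono)
qed

end
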